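(* As an identity of formal power series in $q$ (equivalently, for $|q|<1$), \[ \sum_{n\geq 0} F_0(n) q^n = \frac{(q^{16},-q^6,-q^{10};q^{16})_\infty}{(q;q^2)_\infty (q^2;q^2)_\infty^2}. \]
   Context: Notation: $(a;q)_\infty=\prod_{j=0}^\infty(1-aq^j)$ and $(a_1,\ldots,a_k;q)_\infty=\prod_{j=1}^k (a_j;q)_\infty$. A two-color partition of $n$ is a finite multiset of positive integers (parts), each part colored red or blue, whose sum is $n$ (the same integer in two different colors counts as two different kinds of parts). For a nonnegative integer $n$, $\mathcal{F}(n)$ is the set of two-color partitions of $n$ in which even parts may occur only in blue color (odd parts may occur in either color; repetitions are allowed). $F_0(n)$ is the number of partitions in $\mathcal{F}(n)$ in which the number of red odd parts (counted with multiplicity) is even. *)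

theory Defs
  imports
    "HOL-Analysis.Analysis"
    "HOL-Computational_Algebra.Formal_Power_Series"
    "HOL-Library.Multiset"
begin

datatype color = Red | Blue

definition two_color_partitions :: "nat \<Rightarrow> (nat \<times> color) multiset set" where
  "two_color_partitions n =
     {P. (\<forall>p\<in>#P. fst p > 0) \<and> (\<Sum>p\<in>#P. fst p) = n}"

definition partitions_F :: "nat \<Rightarrow> (nat \<times> color) multiset set" where
  "partitions_F n =
     {P \<in> two_color_partitions n. \<forall>p\<in>#P. even (fst p) \<longrightarrow> snd p = Blue}"

definition num_red_odd :: "(nat \<times> color) multiset \<Rightarrow> nat" where
  "num_red_odd P = size {#p \<in># P. snd p = Red \<and> odd (fst p)#}"

definition F0 :: "nat \<Rightarrow> nat" where
  "F0 n = card {P \<in> partitions_F n. even (num_red_odd P)}"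

text \<open>The cardinality above is that of a finite set, so the convention that infinite sets have
  cardinality 0 plays no role.\<close>

lemma finite_two_color_partitions: "finite (two_color_partitions n)"
proof -
  have UNIV_color: "(UNIV :: color set) = {Red, Blue}"
    using color.exhaust by auto
  define A :: "(nat \<times> color) set" where "A = {0..n} \<times> UNIV"
  have finA: "finite A"
    by (simp add: A_def UNIV_color)
  have "P \<in> mset ` {xs. set xs \<subseteq> A \<and> length xs \<le> n}" if P: "P \<in> two_color_partitions n" for P
  proof -
    obtain xs where xs: "P = mset xs"
      using ex_mset by metis
    have pos: "\<And>p. p \<in> set xs \<Longrightarrow> fst p > 0" and s: "sum_list (map fst xs) = n"
      using P by (auto simp: two_color_partitions_def xs simp flip: sum_mset_sum_list)
    have "p \<in> A" if "p \<in> set xs" for p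
      using member_le_sum_list[of "fst p" "map fst xs"] that s
      by (cases p) (force simp: A_def)
    moreover have "length xs \<le> sum_list (map fst xs)"
      using pos by (induction xs) (force simp: Suc_le_eq)+
    ultimately show ?thesis
      using s xs by blast
  qed
  then have "two_color_partitions n \<subseteq> mset ` {xs. set xs \<subseteq> A \<and> length xs \<le> n}"
    by blast
  then show ?thesis
    using finite_lists_length_le[OF finA] finite_subset by blast
qed

definition qpoch_inf :: "'a \<Rightarrow> 'a \<Rightarrow> 'a :: {t2_space, comm_ring_1}" where
  "qpoch_inf a q = (\<Prod>j. 1 - a * q ^ j)"

definition qpochs_inf :: "'a list \<Rightarrow> 'a \<Rightarrow> 'a :: {t2_space, comm_ring_1}" where
  "qpochs_inf as q = (\<Prod>a\<leftarrow>as. qpoch_inf a q)"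

text \<open>For formal power series the limit of the partial products is taken in the topology of
  coefficientwise stabilization (the metric on \<^typ>\<open>'a fps\<close>). The product converges
  whenever the constant coefficients of \<open>a\<close> and \<open>q\<close> vanish, and then its
  constant coefficient is 1. In particular quotients by such products are genuine ones.\<close>

lemma fps_qpoch_inf:
  fixes a q :: "'a :: idom fps"
  assumes a: "fps_nth a 0 = 0" and q: "fps_nth q 0 = 0"
  shows "(\<lambda>j. 1 - a * q ^ j) has_prod qpoch_inf a q" and "fps_nth (qpoch_inf a q) 0 = 1"
proof -
  define P where "P = (\<lambda>n. \<Prod>j\<le>n. 1 - a * q ^ j)"
  define L where "L = Abs_fps (\<lambda>k. fps_nth (P k) k)"
  have qpow: "fps_nth (q ^ n) i = 0" if "i < n" for n i
    using startsby_zero_power_prefix[OF q] that by blast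
  have step: "fps_nth (P (Suc n)) k = fps_nth (P n) k" if "k \<le> n" for n k
  proof -
    have eq: "P (Suc n) = P n - q ^ Suc n * (a * P n)"
      by (simp add: P_def algebra_simps)
    have "fps_nth (q ^ Suc n * (a * P n)) k = 0"
      using that by (subst fps_mult_nth, intro sum.neutral ballI) (simp add: qpow del: power_Suc)
    then show ?thesis
      by (simp only: eq fps_sub_nth diff_zero)
  qed
  have stable: "fps_nth (P n) k = fps_nth L k" if "k \<le> n" for n k
    using that by (induction n rule: dec_induct) (simp_all add: L_def step)
  have lim: "P \<longlonglongrightarrow> L"
    unfolding tendsto_fps_iff using stable by (auto simp: eventually_sequentially intro!: tendsto_eventually)
  have L0: "fps_nth L 0 = 1"
    by (simp add: L_def P_def a)
  have "(\<lambda>j. 1 - a * q ^ j) has_prod L"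
    using lim L0 by (auto simp: has_prod_def raw_has_prod_def P_def)
  moreover from this have "qpoch_inf a q = L"
    unfolding qpoch_inf_def using has_prod_unique by metis
  ultimately show "(\<lambda>j. 1 - a * q ^ j) has_prod qpoch_inf a q" "fps_nth (qpoch_inf a q) 0 = 1"
    using L0 by simp_all
qed

end

theory Submission
  imports Defs
begin

text \<open>Give every red odd part the weight \<open>z\<close>. The generating function of the partitions counted by
\<^const>\<open>partitions_F\<close> is then
\<open>1 / ((q; q\<^sup>2) (z q; q\<^sup>2) (q\<^sup>2; q\<^sup>2))\<close>, all products being infinite, and averaging its values at
\<open>z = 1\<close> and \<open>z = -1\<close> selects the partitions with evenly many red odd parts. Hence
\<open>2 (q; q\<^sup>2) (q\<^sup>2; q\<^sup>2)\<^sup>2\<close> times the series of \<^const>\<open>F0\<close> equals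
\<open>(q\<^sup>2; q\<^sup>2) / (q; q\<^sup>2) + (q\<^sup>2; q\<^sup>2) / (-q; q\<^sup>2)\<close>.

The first summand is Gauss's series \<open>\<psi>(q)\<close>, the sum of \<open>q ^ (2 k\<^sup>2 - k)\<close> over all integers \<open>k\<close>,
and the second one is \<open>\<psi>(-q)\<close>. So the sum is twice the even part of \<open>\<psi>(q)\<close>, to which exactly the even
\<open>k = 2 m\<close> contribute: it is twice the sum of \<open>q ^ (8 m\<^sup>2 - 2 m)\<close>. The Jacobi triple product turns
this theta series back into the product in the numerator of the claim.

In Ramanujan's notation \<open>f(u, v)\<close> for the sum of \<open>u ^ (k (k + 1) / 2) * v ^ (k (k - 1) / 2)\<close> over the
integers \<open>k\<close>, the argument is \<open>f(q, q\<^sup>3) + f(-q, -q\<^sup>3) = 2 f(q\<^sup>6, q\<^sup>1\<^sup>0)\<close>, an instance of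
\<open>f(u, v) + f(-u, -v) = 2 f(u\<^sup>3 v, u v\<^sup>3)\<close>; see \<open>triple_product_even_part\<close>. The other two pillars are
\<open>jacobi_triple_product\<close> and the generating function \<open>partitions_F_fps_product\<close>. All limits are
coefficientwise limits of formal power series.\<close>

section \<open>Limits of formal power series\<close>

lemma tendsto_mult_fps:
  fixes f g :: "'b \<Rightarrow> 'a :: ring_1 fps"
  assumes "(f \<longlongrightarrow> a) F" "(g \<longlongrightarrow> b) F"
  shows "((\<lambda>x. f x * g x) \<longlongrightarrow> a * b) F"
proof (rule tendsto_fpsI)
  fix n
  have "eventually (\<lambda>x. \<forall>i\<in>{..n}. fps_nth (f x) i = fps_nth a i) F"
    "eventually (\<lambda>x. \<forall>i\<in>{..n}. fps_nth (g x) i = fps_nth b i) F"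
    using assms by (intro eventually_ball_finite; simp add: tendsto_fps_iff)+
  then show "eventually (\<lambda>x. fps_nth (f x * g x) n = fps_nth (a * b) n) F"
    by eventually_elim (simp add: fps_mult_nth)
qed

lemma tendsto_add_fps:
  fixes f g :: "'b \<Rightarrow> 'a :: ring_1 fps"
  assumes "(f \<longlongrightarrow> a) F" "(g \<longlongrightarrow> b) F"
  shows "((\<lambda>x. f x + g x) \<longlongrightarrow> a + b) F"
proof (rule tendsto_fpsI)
  fix n
  have "eventually (\<lambda>x. fps_nth (f x) n = fps_nth a n) F"
    "eventually (\<lambda>x. fps_nth (g x) n = fps_nth b n) F"
    using assms by (simp_all add: tendsto_fps_iff)
  then show "eventually (\<lambda>x. fps_nth (f x + g x) n = fps_nth (a + b) n) F"
    by eventually_elim simp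
qed

lemma fps_nth_power_eq_0:
  fixes q :: "'a :: comm_ring_1 fps"
  assumes "fps_nth q 0 = 0" "i < n" "q ^ n dvd d"
  shows "fps_nth d i = 0"
proof -
  from assms(3) obtain c where "d = q ^ n * c" ..
  moreover have "fps_nth (q ^ n) j = 0" if "j \<le> i" for j
    using startsby_zero_power_prefix[OF assms(1)] that assms(2) by auto
  ultimately show ?thesis
    by (simp add: fps_mult_nth)
qed

text \<open>The \<open>q\<close>-adic form of the squeeze principle: two sequences whose difference is divisible by higher and
higher powers of \<open>q\<close> have the same limit. It replaces a dominated convergence argument in the passage
from the finite to the infinite triple product.\<close>

lemma tendsto_fps_if_power_dvd_diff:
  fixes q :: "'a :: comm_ring_1 fps"
  assumes "fps_nth q 0 = 0" and f: "f \<longlonglongrightarrow> a" and dvd: "\<And>n. q ^ n dvd f n - g n"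
  shows "g \<longlonglongrightarrow> a"
proof (rule tendsto_fpsI)
  fix i
  have "eventually (\<lambda>n. fps_nth (f n) i = fps_nth a i) sequentially"
    using f by (simp add: tendsto_fps_iff)
  then show "eventually (\<lambda>n. fps_nth (g n) i = fps_nth a i) sequentially"
    using eventually_gt_at_top[of i]
  proof eventually_elim
    case (elim n)
    with fps_nth_power_eq_0[OF assms(1) _ dvd] show ?case by fastforce
  qed
qed

section \<open>Infinite \<open>q\<close>-products\<close>

lemma qpoch_inf_tendsto:
  fixes a q :: "'a :: idom fps"
  assumes "fps_nth a 0 = 0" "fps_nth q 0 = 0"
  shows "(\<lambda>n. \<Prod>j<n. 1 - a * q ^ j) \<longlonglongrightarrow> qpoch_inf a q"
  using has_prod_imp_tendsto'[OF fps_qpoch_inf(1)[OF assms]] .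

lemma qpoch_inf_nonzero:
  fixes a q :: "'a :: idom fps"
  assumes "fps_nth a 0 = 0" "fps_nth q 0 = 0"
  shows "qpoch_inf a q \<noteq> 0"
  using fps_qpoch_inf(2)[OF assms] by (metis fps_zero_nth zero_neq_one)

text \<open>Factor by factor, \<open>(1 - x) (1 + x) = 1 - x\<^sup>2\<close>.\<close>

lemma qpoch_inf_mult_neg:
  fixes a q :: "'a :: idom fps"
  assumes "fps_nth a 0 = 0" "fps_nth q 0 = 0"
  shows "qpoch_inf a q * qpoch_inf (- a) q = qpoch_inf (a ^ 2) (q ^ 2)"
proof (rule LIMSEQ_unique)
  show "(\<lambda>n. (\<Prod>j<n. 1 - a * q ^ j) * (\<Prod>j<n. 1 - (- a) * q ^ j))
      \<longlonglongrightarrow> qpoch_inf a q * qpoch_inf (- a) q"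
    using assms by (intro tendsto_mult_fps qpoch_inf_tendsto) auto
  have "(1 - a * q ^ j) * (1 - (- a) * q ^ j) = 1 - a ^ 2 * (q ^ 2) ^ j" for j
    by (simp add: algebra_simps power2_eq_square power_mult_distrib)
  then have "(\<Prod>j<n. 1 - a * q ^ j) * (\<Prod>j<n. 1 - (- a) * q ^ j) =
      (\<Prod>j<n. 1 - a ^ 2 * (q ^ 2) ^ j)" for n
    unfolding prod.distrib[symmetric] by simp
  then show "(\<lambda>n. (\<Prod>j<n. 1 - a * q ^ j) * (\<Prod>j<n. 1 - (- a) * q ^ j))
      \<longlonglongrightarrow> qpoch_inf (a ^ 2) (q ^ 2)"
    using qpoch_inf_tendsto[of "a ^ 2" "q ^ 2"] assms by (simp add: power2_eq_square)
qed

text \<open>The factors with even and with odd index are collected separately.\<close>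

lemma qpoch_inf_split:
  fixes a q :: "'a :: idom fps"
  assumes "fps_nth a 0 = 0" "fps_nth q 0 = 0"
  shows "qpoch_inf a q = qpoch_inf a (q ^ 2) * qpoch_inf (a * q) (q ^ 2)"
proof (rule LIMSEQ_unique)
  have "(\<lambda>n. \<Prod>j<2 * n. 1 - a * q ^ j) \<longlonglongrightarrow> qpoch_inf a q"
    using LIMSEQ_subseq_LIMSEQ[OF qpoch_inf_tendsto[OF assms], of "\<lambda>n. 2 * n"]
    by (simp add: strict_mono_def o_def)
  moreover have "(\<Prod>j<2 * n. 1 - a * q ^ j) =
      (\<Prod>j<n. 1 - a * (q ^ 2) ^ j) * (\<Prod>j<n. 1 - a * q * (q ^ 2) ^ j)" for n
    by (induction n) (simp_all add: mult_ac power_mult [symmetric])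
  ultimately show "(\<lambda>n. (\<Prod>j<n. 1 - a * (q ^ 2) ^ j) * (\<Prod>j<n. 1 - a * q * (q ^ 2) ^ j))
      \<longlonglongrightarrow> qpoch_inf a q"
    by simp
  show "(\<lambda>n. (\<Prod>j<n. 1 - a * (q ^ 2) ^ j) * (\<Prod>j<n. 1 - a * q * (q ^ 2) ^ j))
      \<longlonglongrightarrow> qpoch_inf a (q ^ 2) * qpoch_inf (a * q) (q ^ 2)"
    using assms by (intro tendsto_mult_fps qpoch_inf_tendsto) (auto simp: power2_eq_square)
qed

section \<open>The Jacobi triple product\<close>

text \<open>The terms of Ramanujan's theta function \<open>f(u, v)\<close>. Both exponents are triangular numbers, hence natural
for negative \<open>k\<close> as well, so no inverses of \<open>u\<close> and \<open>v\<close> are involved.\<close>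

definition theta_term :: "'a :: comm_ring_1 \<Rightarrow> 'a \<Rightarrow> int \<Rightarrow> 'a" where
  "theta_term u v k = u ^ nat (k * (k + 1) div 2) * v ^ nat (k * (k - 1) div 2)"

lemma triangular_int:
  obtains a :: nat where "2 * int a = k * (k + 1)"
proof -
  have "0 \<le> k * (k + 1)"
    by (cases "0 \<le> k") (auto intro: mult_nonpos_nonpos)
  moreover have "2 * (k * (k + 1) div 2) = k * (k + 1)"
    by simp
  ultimately show thesis
    using that[of "nat (k * (k + 1) div 2)"] by simp
qed

lemma theta_term_eq:
  assumes "2 * int a = k * (k + 1)" "2 * int b = k * (k - 1)"
  shows "theta_term u v k = u ^ a * v ^ b"
proof -
  have "k * (k + 1) div 2 = int a" "k * (k - 1) div 2 = int b"
    unfolding assms[symmetric] by simp_all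
  then show ?thesis
    by (simp add: theta_term_def)
qed

lemma theta_term_exponents:
  obtains a b :: nat where "2 * int a = k * (k + 1)" "2 * int b = k * (k - 1)"
proof -
  obtain a where "2 * int a = k * (k + 1)"
    by (rule triangular_int)
  moreover obtain b where "2 * int b = (k - 1) * (k - 1 + 1)"
    by (rule triangular_int)
  ultimately show thesis
    by (intro that[of a b]) (simp_all add: mult.commute)
qed

text \<open>Formally, \<open>theta_term u v (k + 1) / theta_term u v k = u * (u * v) ^ k\<close>. Multiplying by a power
of \<open>u * v\<close> that makes all exponents natural gives a version valid in every commutative ring; this version
is what one more factor \<open>1 + u * (u * v) ^ m\<close> produces.\<close>

lemma theta_term_shift:
  assumes "k \<le> int m"
  shows "u * (u * v) ^ m * theta_term u v k = (u * v) ^ nat (int m - k) * theta_term u v (k + 1)"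
proof -
  obtain a b where a: "2 * int a = k * (k + 1)" and b: "2 * int b = k * (k - 1)"
    by (rule theta_term_exponents)
  obtain c where c: "2 * int c = (k + 1) * (k + 1 + 1)"
    by (rule triangular_int)
  have "int b = int a - k" "int c = int a + k + 1"
    using a b c by (simp_all add: algebra_simps)
  then have "1 + m + a = nat (int m - k) + c" "m + b = nat (int m - k) + a"
    using assms by linarith+
  moreover have "theta_term u v (k + 1) = u ^ c * v ^ a"
    using a c by (intro theta_term_eq) (simp_all add: algebra_simps)
  moreover have "u * (u * v) ^ m * (u ^ a * v ^ b) = u ^ (1 + m + a) * v ^ (m + b)"
    by (simp add: power_add power_mult_distrib mult_ac)
  ultimately show ?thesis
    by (simp add: theta_term_eq[OF a b] power_add power_mult_distrib mult_ac del: One_nat_def)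
qed

lemma theta_term_swap: "theta_term v u (- k) = theta_term u v k"
  by (simp add: theta_term_def algebra_simps)

text \<open>The exponents of \<open>theta_term u v k\<close> grow quadratically in \<open>k\<close>, but a linear bound suffices to make the tails of the
theta series small. The extra factor \<open>u * v\<close> makes the bound true for all \<open>k\<close>; for
example, the exponent of \<open>v\<close> is only 1 for \<open>k = 2\<close>, and so is that of \<open>u\<close> for \<open>k = -2\<close>.\<close>

lemma power_abs_dvd_theta_term: "(u * v) ^ nat \<bar>k\<bar> dvd (u * v) * theta_term u v k"
proof -
  obtain a b where a: "2 * int a = k * (k + 1)" and b: "2 * int b = k * (k - 1)"
    by (rule theta_term_exponents)
  \<comment> \<open>No integer lies strictly between 1 and 2, nor between \<open>-2\<close> and \<open>-1\<close>.\<close>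
  have "0 \<le> (k - 1) * (k - 2)" "0 \<le> (k + 1) * (k + 2)"
    by (cases "k \<le> 1"; force intro: mult_nonpos_nonpos)
       (cases "k \<le> -2"; force intro: mult_nonpos_nonpos)
  then have "nat \<bar>k\<bar> \<le> 1 + a" "nat \<bar>k\<bar> \<le> 1 + b"
    using a b by (auto simp: algebra_simps abs_if nat_le_iff)
  then have "u ^ nat \<bar>k\<bar> * v ^ nat \<bar>k\<bar> dvd u ^ (1 + a) * v ^ (1 + b)"
    by (intro mult_dvd_mono le_imp_power_dvd)
  moreover have "(u * v) * theta_term u v k = u ^ (1 + a) * v ^ (1 + b)"
    by (simp add: theta_term_eq[OF a b] mult_ac)
  ultimately show ?thesis
    by (simp add: power_mult_distrib)
qed

text \<open>The finite product \<open>(q; q)\<^sub>n\<close>; this is the \<open>q\<close>-factorial without its usual denominator \<open>(1 - q) ^ n\<close>.\<close>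

definition qfact :: "'a :: comm_ring_1 \<Rightarrow> nat \<Rightarrow> 'a" where
  "qfact q n = (\<Prod>i<n. 1 - q ^ Suc i)"

text \<open>Gaussian binomial coefficients. The constant coefficient of \<^term>\<open>q\<close> is meant to vanish: then every
\<^const>\<open>qfact\<close> has constant coefficient 1, so the inverses are genuine.\<close>

definition qbinom :: "'a :: field fps \<Rightarrow> nat \<Rightarrow> nat \<Rightarrow> 'a fps" where
  "qbinom q n k =
     (if k \<le> n then qfact q n * inverse (qfact q k) * inverse (qfact q (n - k)) else 0)"

lemma qfact_simps [simp]:
  "qfact q 0 = 1" "qfact q (Suc n) = qfact q n * (1 - q ^ Suc n)"
  by (simp_all add: qfact_def)

lemma qfact_nth_0:
  fixes q :: "'a :: field fps"
  assumes "fps_nth q 0 = 0"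
  shows "fps_nth (qfact q n) 0 = 1"
  using assms by (induction n) simp_all

lemma qfact_cancel:
  fixes q :: "'a :: field fps"
  assumes "fps_nth q 0 = 0"
  shows "qfact q n * inverse (qfact q n) = 1"
  using qfact_nth_0[OF assms, of n] by (simp add: inverse_mult_eq_1')

lemma qbinom_mult_qfact:
  assumes "fps_nth q 0 = 0" "k \<le> n"
  shows "qbinom q n k * (qfact q k * qfact q (n - k)) = qfact q n"
proof -
  have "qbinom q n k * (qfact q k * qfact q (n - k)) =
    qfact q n * (qfact q k * inverse (qfact q k)) * (qfact q (n - k) * inverse (qfact q (n - k)))"
    using assms(2) by (simp add: qbinom_def mult_ac)
  then show ?thesis
    by (simp add: qfact_cancel[OF assms(1)])
qed

lemma qbinom_eqI:
  assumes "fps_nth q 0 = 0" "k \<le> n" "x * (qfact q k * qfact q (n - k)) = qfact q n"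
  shows "qbinom q n k = x"
proof -
  have "qfact q k * qfact q (n - k) \<noteq> 0"
    using qfact_nth_0[OF assms(1)] by (metis fps_zero_nth mult_eq_0_iff zero_neq_one)
  then show ?thesis
    using assms(3) qbinom_mult_qfact[OF assms(1,2)] by (metis mult_right_cancel)
qed

lemma qbinom_0:
  assumes "fps_nth q 0 = 0"
  shows "qbinom q n 0 = 1"
  by (rule qbinom_eqI[OF assms]) simp_all

lemma qbinom_symmetric: "k \<le> n \<Longrightarrow> qbinom q n (n - k) = qbinom q n k"
  by (simp add: qbinom_def)

lemma qbinom_pascal:
  assumes q: "fps_nth q 0 = 0" and "k \<le> n"
  shows "qbinom q (Suc n) (Suc k) = qbinom q n (Suc k) + q ^ (n - k) * qbinom q n k"
proof (rule qbinom_eqI[OF q])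
  show "(qbinom q n (Suc k) + q ^ (n - k) * qbinom q n k) *
      (qfact q (Suc k) * qfact q (Suc n - Suc k)) = qfact q (Suc n)"
  proof (cases "k = n")
    case True
    have "qbinom q n (Suc n) = 0" "qbinom q n n = 1"
      using qfact_cancel[OF q] by (simp_all add: qbinom_def)
    with True show ?thesis
      by simp
  next
    case False
    then obtain d where d: "n = Suc (k + d)"
      using \<open>k \<le> n\<close> by (metis le_imp_less_or_eq less_imp_Suc_add)
    have 1: "qbinom q n (Suc k) * (qfact q (Suc k) * qfact q d) = qfact q n"
      using qbinom_mult_qfact[OF q, of "Suc k" n] by (simp add: d)
    have 2: "qbinom q n k * (qfact q k * qfact q (Suc d)) = qfact q n"
      using qbinom_mult_qfact[OF q, of k n] by (simp add: d)
    have "(qbinom q n (Suc k) + q ^ Suc d * qbinom q n k) * (qfact q (Suc k) * qfact q (Suc d)) =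
        qbinom q n (Suc k) * (qfact q (Suc k) * qfact q d) * (1 - q ^ Suc d) +
        q ^ Suc d * (1 - q ^ Suc k) * (qbinom q n k * (qfact q k * qfact q (Suc d)))"
      by (simp add: algebra_simps)
    also have "\<dots> = qfact q n * (1 - q ^ Suc d * q ^ Suc k)"
      unfolding 1 2 by (simp add: algebra_simps)
    also have "\<dots> = qfact q (Suc n)"
      by (simp add: d power_add mult_ac)
    finally show ?thesis
      by (simp add: d)
  qed
qed (use \<open>k \<le> n\<close> in simp)

text \<open>Multiplying by \<open>1 + u * (u * v) ^ m\<close> adds to the coefficient of each theta term that of its left neighbour, by
\<open>theta_term_shift\<close> with the factor \<open>(u * v) ^ (m + n - j)\<close>, which is just the factor that occurs in Pascal's rule
for Gaussian binomial coefficients.\<close>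

lemma finite_triple_product_step:
  fixes u v :: "'a :: field fps"
  assumes q: "fps_nth (u * v) 0 = 0"
  shows "(1 + u * (u * v) ^ m) * (\<Sum>j\<le>m + n. qbinom (u * v) (m + n) j * theta_term u v (int j - int n))
    = (\<Sum>j\<le>Suc m + n. qbinom (u * v) (Suc m + n) j * theta_term u v (int j - int n))"
proof -
  define B where "B = qbinom (u * v) (m + n)"
  define B' where "B' = qbinom (u * v) (Suc (m + n))"
  define T where "T = (\<lambda>j. theta_term u v (int j - int n))"
  have shift: "u * (u * v) ^ m * T j = (u * v) ^ (m + n - j) * T (Suc j)" if "j \<le> m + n" for j
  proof -
    have "nat (int m - (int j - int n)) = m + n - j" using that by auto
    moreover have "int j - int n + 1 = int (Suc j) - int n" by simp
    ultimately show ?thesis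
      using theta_term_shift[of "int j - int n" m u v] that by (simp only: T_def)
  qed
  have B0: "B 0 = 1" "B' 0 = 1" "B (Suc (m + n)) = 0"
    by (simp_all add: B_def B'_def qbinom_0[OF q]) (simp add: qbinom_def)
  have "(\<Sum>j\<le>Suc (m + n). B' j * T j) = T 0 + (\<Sum>j\<le>m + n. B' (Suc j) * T (Suc j))"
    by (subst sum.atMost_Suc_shift) (simp add: B0)
  also have "(\<Sum>j\<le>m + n. B' (Suc j) * T (Suc j)) =
      (\<Sum>j\<le>m + n. B (Suc j) * T (Suc j) + u * (u * v) ^ m * (B j * T j))"
  proof (rule sum.cong[OF refl])
    fix j assume "j \<in> {..m + n}"
    then have j: "j \<le> m + n" by simp
    have "B' (Suc j) * T (Suc j) =
        B (Suc j) * T (Suc j) + B j * ((u * v) ^ (m + n - j) * T (Suc j))"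
      unfolding B_def B'_def qbinom_pascal[OF q j] by (simp add: algebra_simps)
    then show "B' (Suc j) * T (Suc j) = B (Suc j) * T (Suc j) + u * (u * v) ^ m * (B j * T j)"
      unfolding shift[OF j, symmetric] by (simp add: mult_ac)
  qed
  also have "T 0 + \<dots> = (\<Sum>j\<le>Suc (m + n). B j * T j) + u * (u * v) ^ m * (\<Sum>j\<le>m + n. B j * T j)"
    by (subst sum.atMost_Suc_shift) (simp add: B0 sum.distrib sum_distrib_left add_ac)
  also have "\<dots> = (1 + u * (u * v) ^ m) * (\<Sum>j\<le>m + n. B j * T j)"
    by (simp add: B0 algebra_simps)
  finally show ?thesis
    by (simp add: B_def B'_def T_def)
qed

text \<open>A finite form of the Jacobi triple product, going back to Cauchy and equivalent to the \<open>q\<close>-binomial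
theorem. The two products are built up one factor at a time. The factors with \<open>v\<close> come in through the symmetry that
exchanges \<open>u\<close> with \<open>v\<close> and \<open>k\<close> with \<open>-k\<close>.\<close>

lemma finite_triple_product:
  fixes u v :: "'a :: field fps"
  assumes q: "fps_nth (u * v) 0 = 0"
  shows "(\<Prod>j<m. 1 + u * (u * v) ^ j) * (\<Prod>j<n. 1 + v * (u * v) ^ j) =
    (\<Sum>j\<le>m + n. qbinom (u * v) (m + n) j * theta_term u v (int j - int n))"
proof (induction m)
  case 0
  have q': "fps_nth (v * u) 0 = 0"
    using q by (simp add: mult.commute)
  have "(\<Prod>j<n. 1 + v * (v * u) ^ j) = (\<Sum>j\<le>n. qbinom (v * u) n j * theta_term v u (int j))"
  proof (induction n)
    case 0
    show ?case by (simp add: qbinom_0[OF q'] theta_term_def)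
  next
    case (Suc n)
    with finite_triple_product_step[OF q', of n 0] show ?case by (simp add: mult.commute)
  qed
  also have "\<dots> = (\<Sum>j\<le>n. qbinom (u * v) n j * theta_term u v (int j - int n))"
  proof (rule sum.reindex_bij_witness[where i = "\<lambda>j. n - j" and j = "\<lambda>j. n - j"])
    fix j assume "j \<in> {..n}"
    then have "int (n - j) - int n = - int j" by auto
    then show "qbinom (u * v) n (n - j) * theta_term u v (int (n - j) - int n) =
        qbinom (v * u) n j * theta_term v u (int j)"
      using \<open>j \<in> {..n}\<close> by (simp add: qbinom_symmetric theta_term_swap mult.commute)
  qed auto
  finally show ?case
    by (simp add: mult.commute)
next
  case (Suc m)
  have "(\<Prod>j<Suc m. 1 + u * (u * v) ^ j) * (\<Prod>j<n. 1 + v * (u * v) ^ j) =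
      (1 + u * (u * v) ^ m) * ((\<Prod>j<m. 1 + u * (u * v) ^ j) * (\<Prod>j<n. 1 + v * (u * v) ^ j))"
    by (simp add: mult_ac)
  then show ?case
    unfolding Suc finite_triple_product_step[OF q] .
qed

lemma power_dvd_qfact_diff:
  assumes "e \<le> n"
  shows "q ^ Suc e dvd qfact q n - qfact q e"
  using assms
proof (induction n rule: dec_induct)
  case (step n)
  have "qfact q (Suc n) - qfact q e = (qfact q n - qfact q e) - qfact q n * q ^ Suc n"
    by (simp add: algebra_simps)
  moreover have "q ^ Suc e dvd qfact q n * q ^ Suc n"
    using step by (intro dvd_mult le_imp_power_dvd) simp
  ultimately show ?case
    using step by (metis dvd_diff)
qed simp

text \<open>As \<open>n\<close> grows, the central Gaussian binomial coefficients approach \<open>1 / (q; q)\<close>, and this is the rate. Modulo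
\<open>q ^ (e + 1)\<close> the value of \<^term>\<open>qfact q m\<close> is the same for all \<open>m \<ge> e\<close>, so the four \<open>q\<close>-factorials in the
expression cancel.\<close>

lemma power_dvd_central_qbinom:
  assumes q: "fps_nth q 0 = 0" and e: "e \<le> j" "j + e \<le> 2 * n"
  shows "q ^ Suc e dvd qfact q n * qbinom q (2 * n) j - 1"
proof -
  have "e \<le> n" "e \<le> 2 * n" "e \<le> 2 * n - j" "j \<le> 2 * n"
    using e by auto
  note D = power_dvd_qfact_diff[where q = q]
  define f where "f = qfact q e"
  define M where "M = q ^ Suc e"
  have diff: "M dvd x * y - z * w"
    if "M dvd x - f" "M dvd y - f" "M dvd z - f" "M dvd w - f" for x y z w
  proof -
    have "x * y - z * w = (x - f) * y + f * (y - f) - (z - f) * w - f * (w - f)"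
      by (simp add: algebra_simps)
    with that show ?thesis
      by (simp add: dvd_add dvd_diff)
  qed
  define I where "I = inverse (qfact q j) * inverse (qfact q (2 * n - j))"
  have I: "qfact q j * qfact q (2 * n - j) * I = 1"
  proof -
    have "qfact q j * qfact q (2 * n - j) * I =
      (qfact q j * inverse (qfact q j)) * (qfact q (2 * n - j) * inverse (qfact q (2 * n - j)))"
      by (simp add: I_def mult_ac)
    then show ?thesis by (simp add: qfact_cancel[OF q])
  qed
  have "M dvd (qfact q n * qfact q (2 * n) - qfact q j * qfact q (2 * n - j)) * I"
    unfolding M_def f_def
    by (intro dvd_mult2 diff[unfolded M_def f_def] D) fact+
  also have "(qfact q n * qfact q (2 * n) - qfact q j * qfact q (2 * n - j)) * I =
      qfact q n * qbinom q (2 * n) j - 1"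
    using \<open>j \<le> 2 * n\<close> unfolding left_diff_distrib I by (simp add: I_def qbinom_def mult_ac)
  finally show ?thesis
    by (simp add: M_def)
qed

text \<open>Multiply the finite identity with \<open>m = n\<close> by \<open>(u v; u v)\<^sub>n\<close>. Near the centre the coefficients are close to
1; further out they are not, but there the theta terms themselves are small. The two effects balance: each
term differs from \<open>theta_term u v k\<close> by a multiple of \<open>(u v) ^ n\<close>.\<close>

theorem jacobi_triple_product:
  fixes u v :: "'a :: field fps"
  assumes u: "fps_nth u 0 = 0" and v: "fps_nth v 0 = 0"
  shows "(\<lambda>n. \<Sum>k = - int n..int n. theta_term u v k) \<longlonglongrightarrow>
    qpoch_inf (u * v) (u * v) * (qpoch_inf (- u) (u * v) * qpoch_inf (- v) (u * v))"
proof (rule tendsto_fps_if_power_dvd_diff)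
  define q where "q = u * v"
  have q: "fps_nth q 0 = 0"
    by (simp add: q_def u)
  show "fps_nth (u * v) 0 = 0" using q by (simp add: q_def)
  let ?P = "\<lambda>n. qfact q n * ((\<Prod>j<n. 1 + u * q ^ j) * (\<Prod>j<n. 1 + v * q ^ j))"
  show "?P \<longlonglongrightarrow>
      qpoch_inf (u * v) (u * v) * (qpoch_inf (- u) (u * v) * qpoch_inf (- v) (u * v))"
    using qpoch_inf_tendsto[of q q] qpoch_inf_tendsto[of "- u" q] qpoch_inf_tendsto[of "- v" q]
      q u v
    by (intro tendsto_mult_fps) (simp_all add: q_def qfact_def)
  fix n
  let ?T = "\<lambda>j. theta_term u v (int j - int n)"
  have "(\<Sum>k = - int n..int n. theta_term u v k) = (\<Sum>j\<le>2 * n. ?T j)"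
    by (rule sum.reindex_bij_witness[where i = "\<lambda>j. int j - int n" and j = "\<lambda>k. nat (k + int n)"])
       auto
  moreover have "?P n = (\<Sum>j\<le>2 * n. qfact q n * qbinom q (2 * n) j * ?T j)"
    using finite_triple_product[of u v n n] q
    by (simp add: q_def sum_distrib_left mult_ac flip: mult_2)
  ultimately have "?P n - (\<Sum>k = - int n..int n. theta_term u v k) =
      (\<Sum>j\<le>2 * n. (qfact q n * qbinom q (2 * n) j - 1) * ?T j)"
    by (simp add: sum_subtractf[symmetric] left_diff_distrib)
  also have "q ^ n dvd \<dots>"
  proof (rule dvd_sum)
    fix j assume "j \<in> {..2 * n}"
    \<comment> \<open>The distance of \<open>j\<close> to the ends of \<open>{..2 * n}\<close> measures the accuracy of the coefficient; its
      distance to the centre measures the smallness of the theta term.\<close>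
    define e where "e = min j (2 * n - j)"
    have e: "e \<le> j" "j + e \<le> 2 * n" "n = e + nat \<bar>int j - int n\<bar>"
      using \<open>j \<in> {..2 * n}\<close> by (auto simp: e_def min_def)
    obtain c where c: "qfact q n * qbinom q (2 * n) j - 1 = q ^ Suc e * c"
      using power_dvd_central_qbinom[OF q e(1,2)] by blast
    have "q ^ e * q ^ nat \<bar>int j - int n\<bar> dvd q ^ e * (q * ?T j)"
      using power_abs_dvd_theta_term[of u v] by (intro mult_dvd_mono) (simp_all add: q_def)
    then have "q ^ n dvd q ^ e * (q * ?T j)"
      using e(3) by (simp flip: power_add)
    then have "q ^ n dvd (q ^ e * (q * ?T j)) * c"
      by (rule dvd_mult2)
    then show "q ^ n dvd (qfact q n * qbinom q (2 * n) j - 1) * ?T j"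
      unfolding c by (simp add: mult_ac)
  qed
  finally show "(u * v) ^ n dvd ?P n - (\<Sum>k = - int n..int n. theta_term u v k)"
    by (simp add: q_def)
qed

lemma theta_term_double: "theta_term u v (2 * k) = theta_term (u ^ 3 * v) (u * v ^ 3) k"
proof -
  obtain a b where a: "2 * int a = k * (k + 1)" and b: "2 * int b = k * (k - 1)"
    by (rule theta_term_exponents)
  have "theta_term u v (2 * k) = u ^ (3 * a + b) * v ^ (a + 3 * b)"
    using a b by (intro theta_term_eq) (simp_all add: algebra_simps)
  also have "\<dots> = (u ^ 3 * v) ^ a * (u * v ^ 3) ^ b"
    by (simp add: power_add power_mult power_mult_distrib)
  also have "\<dots> = theta_term (u ^ 3 * v) (u * v ^ 3) k"
    by (rule theta_term_eq[OF a b, symmetric])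
  finally show ?thesis .
qed

lemma theta_term_minus:
  "theta_term (- u) (- v) k = (if even k then theta_term u v k else - theta_term u v k)"
proof -
  obtain a b where a: "2 * int a = k * (k + 1)" and b: "2 * int b = k * (k - 1)"
    by (rule theta_term_exponents)
  have T: "theta_term x y k = x ^ a * y ^ b" for x y :: 'a
    by (rule theta_term_eq[OF a b])
  have "int (a + b) = k * k"
    using a b by (simp add: algebra_simps)
  then have "even (a + b) \<longleftrightarrow> even k"
    by (metis even_mult_iff even_of_nat)
  moreover have "theta_term (- u) (- v) k = (- 1) ^ (a + b) * theta_term u v k"
    unfolding T power_minus[of u] power_minus[of v] by (simp add: power_add mult_ac)
  ultimately show ?thesis
    by (simp add: uminus_power_if)
qed

text \<open>Changing the signs of \<open>u\<close> and \<open>v\<close> negates exactly the terms with odd \<open>k\<close>, because the two exponents add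
up to \<open>k\<^sup>2\<close>.\<close>

lemma theta_even_part:
  "(\<Sum>k = - int (2 * n)..int (2 * n). theta_term u v k) +
   (\<Sum>k = - int (2 * n)..int (2 * n). theta_term (- u) (- v) k) =
   2 * (\<Sum>k = - int n..int n. theta_term (u ^ 3 * v) (u * v ^ 3) k)"
proof -
  let ?I = "{- int (2 * n)..int (2 * n)}"
  have "(\<Sum>k\<in>?I. theta_term u v k) + (\<Sum>k\<in>?I. theta_term (- u) (- v) k) =
      (\<Sum>k\<in>?I. if even k then 2 * theta_term u v k else 0)"
    unfolding sum.distrib[symmetric] by (intro sum.cong) (simp_all add: theta_term_minus)
  also have "\<dots> = (\<Sum>k\<in>{k\<in>?I. even k}. 2 * theta_term u v k)"
    by (simp only: sum.inter_filter[symmetric] finite_atLeastAtMost_int)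
  also have "\<dots> = (\<Sum>k = - int n..int n. 2 * theta_term u v (2 * k))"
    by (rule sum.reindex_bij_witness[where i = "\<lambda>k. 2 * k" and j = "\<lambda>k. k div 2"]) auto
  finally show ?thesis
    by (simp add: theta_term_double sum_distrib_left)
qed

text \<open>This is \<open>f(u, v) + f(-u, -v) = 2 f(u\<^sup>3 v, u v\<^sup>3)\<close>, with each theta function in product form. It follows
from \<open>theta_even_part\<close>, where the same identity holds already for symmetric partial sums.\<close>

lemma triple_product_even_part:
  fixes u v :: "'a :: field fps"
  assumes u: "fps_nth u 0 = 0" and v: "fps_nth v 0 = 0"
  shows "qpoch_inf (u * v) (u * v) * (qpoch_inf (- u) (u * v) * qpoch_inf (- v) (u * v)) +
    qpoch_inf (u * v) (u * v) * (qpoch_inf u (u * v) * qpoch_inf v (u * v)) =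
    2 * (qpoch_inf ((u * v) ^ 4) ((u * v) ^ 4) *
      (qpoch_inf (- (u ^ 3 * v)) ((u * v) ^ 4) * qpoch_inf (- (u * v ^ 3)) ((u * v) ^ 4)))"
proof (rule LIMSEQ_unique)
  let ?S = "\<lambda>u v n. \<Sum>k = - int n..int n. theta_term u v k"
  have sub: "(\<lambda>n. f (2 * n)) \<longlonglongrightarrow> L" if "f \<longlonglongrightarrow> L" for f and L :: "'a fps"
    using LIMSEQ_subseq_LIMSEQ[OF that, of "\<lambda>n. 2 * n"] by (simp add: strict_mono_def o_def)
  show "(\<lambda>n. ?S u v (2 * n) + ?S (- u) (- v) (2 * n)) \<longlonglongrightarrow>
    qpoch_inf (u * v) (u * v) * (qpoch_inf (- u) (u * v) * qpoch_inf (- v) (u * v)) +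
    qpoch_inf (u * v) (u * v) * (qpoch_inf u (u * v) * qpoch_inf v (u * v))"
    using sub[OF jacobi_triple_product[of u v]] sub[OF jacobi_triple_product[of "- u" "- v"]] u v
    by (intro tendsto_add_fps) simp_all
  have "(u ^ 3 * v) * (u * v ^ 3) = (u * v) ^ 4"
    by (simp add: power_mult_distrib eval_nat_numeral mult_ac)
  then show "(\<lambda>n. ?S u v (2 * n) + ?S (- u) (- v) (2 * n)) \<longlonglongrightarrow>
    2 * (qpoch_inf ((u * v) ^ 4) ((u * v) ^ 4) *
      (qpoch_inf (- (u ^ 3 * v)) ((u * v) ^ 4) * qpoch_inf (- (u * v ^ 3)) ((u * v) ^ 4)))"
    using jacobi_triple_product[of "u ^ 3 * v" "u * v ^ 3"] u v
    unfolding theta_even_part by (intro tendsto_mult_fps tendsto_const) simp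
qed

section \<open>Weighted generating functions of multisets\<close>

definition multisets_of_weight :: "('p \<Rightarrow> nat) \<Rightarrow> 'p set \<Rightarrow> nat \<Rightarrow> 'p multiset set" where
  "multisets_of_weight w A n = {P. set_mset P \<subseteq> A \<and> (\<Sum>p\<in>#P. w p) = n}"

definition multiset_fps :: "('p \<Rightarrow> nat) \<Rightarrow> ('p \<Rightarrow> 'a) \<Rightarrow> 'p set \<Rightarrow> 'a :: comm_ring_1 fps" where
  "multiset_fps w c A = Abs_fps (\<lambda>n. \<Sum>P\<in>multisets_of_weight w A n. \<Prod>p\<in>#P. c p)"

lemma finite_multisets_of_weight:
  assumes "finite A" "\<And>p. p \<in> A \<Longrightarrow> w p > 0"
  shows "finite (multisets_of_weight w A n)"
proof -
  have "P \<in> mset ` {xs. set xs \<subseteq> A \<and> length xs \<le> n}" if P: "P \<in> multisets_of_weight w A n" for P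
  proof -
    obtain xs where xs: "P = mset xs"
      using ex_mset by metis
    have A: "set xs \<subseteq> A" and s: "sum_list (map w xs) = n"
      using P by (auto simp: multisets_of_weight_def xs simp flip: sum_mset_sum_list)
    have "length xs \<le> sum_list (map w xs)"
      using A
    proof (induction xs)
      case (Cons x xs)
      with assms(2)[of x] show ?case by simp
    qed simp
    with A s xs show ?thesis by blast
  qed
  then have "multisets_of_weight w A n \<subseteq> mset ` {xs. set xs \<subseteq> A \<and> length xs \<le> n}"
    by blast
  then show ?thesis
    using finite_lists_length_le[OF assms(1)] finite_subset by blast
qed

text \<open>A multiset over \<open>insert p A\<close> either avoids \<open>p\<close> or arises from a smaller multiset by adding one copy of \<open>p\<close>. Removing
a single copy, rather than all of them, leads to a geometric series as the solution of a linear equation.\<close>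

lemma multisets_of_weight_insert:
  assumes "p \<notin> A"
  shows "multisets_of_weight w (insert p A) n = multisets_of_weight w A n \<union>
    (if w p \<le> n then add_mset p ` multisets_of_weight w (insert p A) (n - w p) else {})"
    (is "?L = ?R")
proof (intro set_eqI iffI)
  fix P assume P: "P \<in> ?L"
  show "P \<in> ?R"
  proof (cases "p \<in># P")
    case True
    then obtain P' where P': "P = add_mset p P'"
      by (metis mset_add)
    with P have "P' \<in> multisets_of_weight w (insert p A) (n - w p)" "w p \<le> n"
      by (auto simp: multisets_of_weight_def)
    with P' show ?thesis by auto
  qed (use P in \<open>auto simp: multisets_of_weight_def\<close>)
qed (auto simp: multisets_of_weight_def split: if_splits)

lemma multiset_fps_insert:
  assumes fin: "finite A" and "p \<notin> A" and w: "\<And>x. x \<in> insert p A \<Longrightarrow> w x > 0"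
  shows "(1 - fps_const (c p) * fps_X ^ w p) * multiset_fps w c (insert p A) = multiset_fps w c A"
proof (rule fps_ext)
  fix n
  let ?M = "multisets_of_weight w" and ?B = "insert p A"
  have f: "finite (?M A m)" "finite (?M ?B m)" for m
    using fin w by (auto intro!: finite_multisets_of_weight)
  show "fps_nth ((1 - fps_const (c p) * fps_X ^ w p) * multiset_fps w c ?B) n =
      fps_nth (multiset_fps w c A) n"
  proof (cases "w p \<le> n")
    case True
    have split: "?M ?B n = ?M A n \<union> add_mset p ` ?M ?B (n - w p)"
      using multisets_of_weight_insert[OF \<open>p \<notin> A\<close>, of w n] by (simp only: True if_True)
    have "p \<notin># P" if "P \<in> ?M A n" for P
      using that \<open>p \<notin> A\<close> unfolding multisets_of_weight_def by blast
    then have disj: "?M A n \<inter> add_mset p ` ?M ?B (n - w p) = {}"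
      by (metis (no_types, lifting) disjoint_iff imageE union_single_eq_member)
    have "(\<Sum>P\<in>?M ?B n. \<Prod>x\<in>#P. c x) = (\<Sum>P\<in>?M A n. \<Prod>x\<in>#P. c x) +
        (\<Sum>P\<in>add_mset p ` ?M ?B (n - w p). \<Prod>x\<in>#P. c x)"
      unfolding split by (rule sum.union_disjoint[OF f(1) finite_imageI[OF f(2)] disj])
    also have "(\<Sum>P\<in>add_mset p ` ?M ?B (n - w p). \<Prod>x\<in>#P. c x) =
        c p * (\<Sum>P\<in>?M ?B (n - w p). \<Prod>x\<in>#P. c x)"
      by (subst sum.reindex) (simp_all add: sum_distrib_left inj_on_def)
    finally show ?thesis
      using True by (simp add: multiset_fps_def left_diff_distrib mult.assoc fps_X_power_mult_nth)
  next
    case False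
    then show ?thesis
      using multisets_of_weight_insert[OF \<open>p \<notin> A\<close>, of w n]
      by (simp add: multiset_fps_def left_diff_distrib mult.assoc fps_X_power_mult_nth)
  qed
qed

lemma prod_mult_multiset_fps:
  assumes "finite A" "\<And>p. p \<in> A \<Longrightarrow> w p > 0"
  shows "(\<Prod>p\<in>A. 1 - fps_const (c p) * fps_X ^ w p) * multiset_fps w c A = 1"
  using assms
proof (induction A)
  case empty
  have "multisets_of_weight w {} n = (if n = 0 then {{#}} else {})" for n
    by (auto simp: multisets_of_weight_def)
  then show ?case
    by (simp add: multiset_fps_def fps_eq_iff)
next
  case (insert p A)
  have "(\<Prod>x\<in>insert p A. 1 - fps_const (c x) * fps_X ^ w x) * multiset_fps w c (insert p A) =
      (\<Prod>x\<in>A. 1 - fps_const (c x) * fps_X ^ w x) *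
      ((1 - fps_const (c p) * fps_X ^ w p) * multiset_fps w c (insert p A))"
    using insert.hyps by (simp add: mult_ac)
  also have "(1 - fps_const (c p) * fps_X ^ w p) * multiset_fps w c (insert p A) =
      multiset_fps w c A"
    by (rule multiset_fps_insert) (use insert in auto)
  finally show ?case
    using insert by simp
qed

section \<open>Partitions with odd parts in two colours\<close>

definition partitions_F_fps :: "'a :: comm_ring_1 \<Rightarrow> 'a fps" where
  "partitions_F_fps z = Abs_fps (\<lambda>n. \<Sum>P\<in>partitions_F n. z ^ num_red_odd P)"

text \<open>Parts of size at most \<open>2 N\<close> contribute a finite product of geometric series, and they determine the
coefficients up to \<open>q ^ (2 N)\<close>. Blue odd, red odd and even parts give the three infinite products in the
limit \<open>N \<rightarrow> \<infinity>\<close>.\<close>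

lemma partitions_F_fps_product:
  fixes z :: "'a :: idom"
  shows "qpoch_inf fps_X (fps_X ^ 2) * qpoch_inf (fps_const z * fps_X) (fps_X ^ 2) *
    qpoch_inf (fps_X ^ 2) (fps_X ^ 2) * partitions_F_fps z = 1"
proof (rule LIMSEQ_unique)
  let ?X = "fps_X :: 'a fps"
  define c where "c = (\<lambda>p :: nat \<times> color. if snd p = Red \<and> odd (fst p) then z else 1)"
  define U where "U = (\<lambda>N :: nat. {p :: nat \<times> color. 0 < fst p \<and> (even (fst p) \<longrightarrow> snd p = Blue) \<and> fst p \<le> 2 * N})"
  define R where "R = (\<lambda>N. (\<lambda>j. (2 * j + 1 :: nat, Red)) ` {..<N})"
  define B where "B = (\<lambda>N. (\<lambda>j. (2 * j + 1 :: nat, Blue)) ` {..<N})"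
  define E where "E = (\<lambda>N. (\<lambda>j. (2 * j + 2 :: nat, Blue)) ` {..<N})"
  define Q where "Q = (\<lambda>a N. \<Prod>j<N. 1 - a * (?X ^ 2) ^ j)"
  have U: "U N = B N \<union> R N \<union> E N" for N
  proof (intro set_eqI iffI)
    fix p assume p: "p \<in> U N"
    obtain k col where [simp]: "p = (k, col)" by (cases p)
    show "p \<in> B N \<union> R N \<union> E N"
    proof (cases "even k")
      case True
      then obtain j where "k = 2 * j" ..
      with p have "k = 2 * (j - 1) + 2" "j - 1 < N" "col = Blue"
        by (auto simp: U_def)
      then show ?thesis by (auto simp: E_def)
    next
      case False
      then obtain j where "k = 2 * j + 1" by (rule oddE)
      with p show ?thesis by (cases col) (auto simp: U_def R_def B_def)
    qed
  qed (auto simp: U_def B_def R_def E_def)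
  have disj: "B N \<inter> R N = {}" "(B N \<union> R N) \<inter> E N = {}" for N
    by (auto simp: B_def R_def E_def) presburger
  have fin: "finite (B N)" "finite (R N)" "finite (E N)" for N
    by (auto simp: B_def R_def E_def)
  have prodU: "(\<Prod>p\<in>U N. 1 - fps_const (c p) * ?X ^ fst p) =
      Q ?X N * Q (fps_const z * ?X) N * Q (?X ^ 2) N" for N
  proof -
    have "(\<Prod>p\<in>B N. 1 - fps_const (c p) * ?X ^ fst p) = Q ?X N"
      unfolding B_def Q_def
      by (subst prod.reindex) (simp_all add: inj_on_def c_def power_mult mult.assoc)
    moreover have "(\<Prod>p\<in>R N. 1 - fps_const (c p) * ?X ^ fst p) = Q (fps_const z * ?X) N"
      unfolding R_def Q_def
      by (subst prod.reindex) (simp_all add: inj_on_def c_def power_mult mult.assoc)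
    moreover have "(\<Prod>p\<in>E N. 1 - fps_const (c p) * ?X ^ fst p) = Q (?X ^ 2) N"
      unfolding E_def Q_def
      by (subst prod.reindex) (simp_all add: inj_on_def c_def power_mult power2_eq_square mult.assoc)
    ultimately show ?thesis
      unfolding U using disj fin by (simp add: prod.union_disjoint)
  qed
  have F: "multisets_of_weight fst (U N) n = partitions_F n" if "n \<le> 2 * N" for n N
  proof -
    have "fst p \<le> 2 * N" if P: "P \<in> partitions_F n" and p: "p \<in># P" for P p
    proof -
      obtain P' where "P = add_mset p P'"
        using p by (metis mset_add)
      with P \<open>n \<le> 2 * N\<close> show ?thesis
        by (auto simp: partitions_F_def two_color_partitions_def)
    qed
    then show ?thesis
      by (auto simp: multisets_of_weight_def U_def partitions_F_def two_color_partitions_def)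
  qed
  have c: "(\<Prod>p\<in>#P. c p) = z ^ num_red_odd P" for P
    by (induction P) (auto simp: num_red_odd_def c_def)
  have lim: "(\<lambda>N. multiset_fps fst c (U N)) \<longlonglongrightarrow> partitions_F_fps z"
  proof (rule tendsto_fpsI)
    fix n
    show "eventually (\<lambda>N. fps_nth (multiset_fps fst c (U N)) n = fps_nth (partitions_F_fps z) n)
        sequentially"
      using eventually_ge_at_top[of n]
      by eventually_elim (simp add: multiset_fps_def partitions_F_fps_def F c)
  qed
  show "(\<lambda>N. Q ?X N * Q (fps_const z * ?X) N * Q (?X ^ 2) N * multiset_fps fst c (U N)) \<longlonglongrightarrow>
      qpoch_inf ?X (?X ^ 2) * qpoch_inf (fps_const z * ?X) (?X ^ 2) *
      qpoch_inf (?X ^ 2) (?X ^ 2) * partitions_F_fps z"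
    unfolding Q_def by (intro tendsto_mult_fps qpoch_inf_tendsto lim) simp_all
  have "Q ?X N * Q (fps_const z * ?X) N * Q (?X ^ 2) N * multiset_fps fst c (U N) = 1" for N
    unfolding prodU[symmetric]
    by (rule prod_mult_multiset_fps) (use U fin in \<open>auto simp: U_def\<close>)
  then show "(\<lambda>N. Q ?X N * Q (fps_const z * ?X) N * Q (?X ^ 2) N * multiset_fps fst c (U N))
      \<longlonglongrightarrow> 1"
    by simp
qed

lemma double_F0:
  "2 * Abs_fps (\<lambda>n. of_nat (F0 n)) = partitions_F_fps 1 + partitions_F_fps (- 1 :: 'a :: idom)"
proof (rule fps_ext)
  fix n
  have fin: "finite (partitions_F n)"
    using finite_two_color_partitions by (rule finite_subset[rotated]) (auto simp: partitions_F_def)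
  have "(\<Sum>P\<in>partitions_F n. 1 ^ num_red_odd P) + (\<Sum>P\<in>partitions_F n. (- 1) ^ num_red_odd P) =
      (\<Sum>P\<in>partitions_F n. if even (num_red_odd P) then 2 else 0 :: 'a)"
    unfolding sum.distrib[symmetric] by (intro sum.cong) auto
  also have "\<dots> = 2 * of_nat (F0 n)"
    using fin by (simp add: F0_def sum.inter_filter[symmetric] mult.commute)
  finally have "(\<Sum>P\<in>partitions_F n. 1 ^ num_red_odd P) +
      (\<Sum>P\<in>partitions_F n. (- 1) ^ num_red_odd P) = (of_nat (F0 n) + of_nat (F0 n) :: 'a)"
    unfolding mult_2 .
  then show "fps_nth (2 * Abs_fps (\<lambda>n. of_nat (F0 n))) n =
      fps_nth (partitions_F_fps 1 + partitions_F_fps (- 1 :: 'a)) n"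
    by (simp only: partitions_F_fps_def mult_2 fps_add_nth fps_nth_Abs_fps)
qed

text \<open>It remains to clear denominators. Writing \<open>O1 = (q; q\<^sup>2)\<close>, \<open>O2 = (-q; q\<^sup>2)\<close> and
\<open>E = (q\<^sup>2; q\<^sup>2)\<close>, the relation \<open>E = (q\<^sup>4; q\<^sup>4) O1 O2\<close> shows that the products
\<open>(q\<^sup>4; q\<^sup>4) O2\<close> and \<open>(q\<^sup>4; q\<^sup>4) O1\<close>, which the triple product gives for \<open>f(q, q\<^sup>3)\<close> and
\<open>f(-q, -q\<^sup>3)\<close>, are \<open>E / O1\<close> and \<open>E / O2\<close>.\<close>

theorem theorem1:
  fixes q :: "complex fps"
  assumes "q = fps_X"
  shows "Abs_fps (\<lambda>n. of_nat (F0 n)) =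
    qpochs_inf [q ^ 16, - (q ^ 6), - (q ^ 10)] (q ^ 16) /
      (qpoch_inf q (q ^ 2) * (qpoch_inf (q ^ 2) (q ^ 2)) ^ 2)"
proof -
  have q0: "fps_nth (q ^ n) 0 = 0" if "n > 0" for n
    using that by (simp add: assms)
  have q1: "fps_nth q 0 = 0"
    by (simp add: assms)
  have pow: "(q ^ 2) ^ 2 = q ^ 4" "q ^ 2 * q ^ 2 = q ^ 4" "q * q ^ 2 = q ^ 3" "q * q ^ 3 = q ^ 4"
    "q ^ 3 * q ^ 3 = q ^ 6" "q * (q ^ 3) ^ 3 = q ^ 10" "(q ^ 4) ^ 4 = q ^ 16"
    by (simp_all add: eval_nat_numeral mult.assoc)
  define O1 where "O1 = qpoch_inf q (q ^ 2)"
  define O2 where "O2 = qpoch_inf (- q) (q ^ 2)"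
  define E where "E = qpoch_inf (q ^ 2) (q ^ 2)"
  define E4 where "E4 = qpoch_inf (q ^ 4) (q ^ 4)"
  define G where "G = qpochs_inf [q ^ 16, - (q ^ 6), - (q ^ 10)] (q ^ 16)"
  define F where "F = Abs_fps (\<lambda>n. of_nat (F0 n) :: complex)"
  have nz: "O1 \<noteq> 0" "O2 \<noteq> 0" "E \<noteq> 0"
    unfolding O1_def O2_def E_def by (rule qpoch_inf_nonzero; simp add: q0 q1)+
  have A: "O1 * O1 * E * partitions_F_fps 1 = 1"
    using partitions_F_fps_product[of "1 :: complex"] by (simp add: O1_def E_def assms)
  have neg: "fps_const (- 1) * q = - q"
    by (metis fps_const_neg fps_const_1_eq_1 mult_minus1)
  have B: "O1 * O2 * E * partitions_F_fps (- 1) = 1"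
    using partitions_F_fps_product[of "- 1 :: complex"]
    unfolding O1_def O2_def E_def assms[symmetric] neg .
  have E: "E = E4 * (O1 * O2)"
  proof -
    have "E = qpoch_inf (q ^ 2) (q ^ 4) * E4"
      using qpoch_inf_split[of "q ^ 2" "q ^ 2"] unfolding E_def E4_def pow by (simp add: q0)
    moreover have "O1 * O2 = qpoch_inf (q ^ 2) (q ^ 4)"
      using qpoch_inf_mult_neg[of q "q ^ 2"] unfolding O1_def O2_def pow by (simp add: q0 q1)
    ultimately show ?thesis by simp
  qed
  have O1: "qpoch_inf q (q ^ 4) * qpoch_inf (q ^ 3) (q ^ 4) = O1"
    using qpoch_inf_split[of q "q ^ 2"] unfolding O1_def pow by (simp add: q0 q1)
  have O2: "qpoch_inf (- q) (q ^ 4) * qpoch_inf (- (q ^ 3)) (q ^ 4) = O2"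
    using qpoch_inf_split[of "- q" "q ^ 2"] unfolding O2_def mult_minus_left pow
    by (simp add: q0 q1)
  have theta: "E4 * O2 + E4 * O1 = 2 * G"
    using triple_product_even_part[of q "q ^ 3"]
    unfolding pow O1 O2 E4_def[symmetric] G_def qpochs_inf_def by (simp add: q0 q1)
  have double: "2 * F = partitions_F_fps 1 + partitions_F_fps (- 1)"
    unfolding F_def by (rule double_F0)
  have "O1 * O2 * (F * (O1 * E ^ 2)) * 2 = (2 * F) * (O1 * O1 * O2 * E * E)"
    by (simp add: power2_eq_square)
  also have "\<dots> = O2 * E * (O1 * O1 * E * partitions_F_fps 1) +
      O1 * E * (O1 * O2 * E * partitions_F_fps (- 1))"
    unfolding double by (simp add: algebra_simps)
  also have "\<dots> = O2 * E + O1 * E"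
    unfolding A B by simp
  also have "\<dots> = O1 * O2 * (E4 * O2 + E4 * O1)"
    unfolding E by (simp add: algebra_simps)
  also have "\<dots> = O1 * O2 * G * 2"
    unfolding theta by simp
  finally have "F * (O1 * E ^ 2) = G"
    using nz by simp
  moreover have "O1 * E ^ 2 \<noteq> 0"
    using nz by simp
  ultimately have "F = G / (O1 * E ^ 2)"
    by (metis nonzero_mult_div_cancel_right)
  then show ?thesis
    unfolding F_def G_def O1_def E_def .
qed

end
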